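(* For every $X\subseteq\omega$, there is no weak embedding of $\mathcal{G}^{X\oplus\overline{X}}$ into $\mathcal{B}^X$; that is, $\mathcal{G}^{X\oplus\overline{X}}\not\hookrightarrow\mathcal{B}^X$.
   Context: For pcas (partial applicative systems satisfying combinatory completeness) $\mathcal{A},\mathcal{C}$, a weak embedding is an injection $F:\mathcal{A}\to\mathcal{C}$ such that for all $a,b\in\mathcal{A}$: if $ab$ is defined in $\mathcal{A}$ then $F(a)F(b)$ is defined in $\mathcal{C}$ and equals $F(ab)$. Scott's graph model $\mathcal{G}$ has domain $\mathcal{P}(\omega)$ with application $A\cdot B=\{n : \exists u\,(\langle n,u\rangle\in A\wedge D_u\subseteq B)\}$, where $D_u$ is the finite set with canonical code $u$. For $Z\subseteq\omega$, $\mathcal{G}^Z$ is the smallest subset of $\mathcal{P}(\omega)$ containing $Z$ and all c.e. sets and closed under this application, with the inherited application. $\overline{X}$ is the complement of $X$ and $X\oplus\overline{X}$ the join. $\mathcal{B}^X$ is the set of partial $X$-computable functions $\omega\to\omega$ with application $f\cdot g$ the partial function $n\mapsto\Phi_{f(0)}^{f\oplus g}(n)$, where $\Phi_e^Z$ is the $e$-th oracle Turing functional and an oracle computation with a partial oracle is undefined as soon as it queries a point where the oracle is undefined. *)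

theory Defs
  imports "HOL-Library.Nat_Bijection"
begin

section \<open>Oracle functionals\<close>

text \<open>
  Turing functionals are presented as Kleene's partial recursive functionals in one function
  oracle, over unary functions with the pairing \<^const>\<open>prod_encode\<close>. Every clause is strict, so a
  computation is undefined as soon as it queries the oracle outside its domain. \<open>Prec\<close> unfolds its
  step function only as often as its recursion argument demands; hence a program can decide whether
  to make a query, and on partial oracles these are exactly the (sequential) functionals of oracle
  Turing machines.
\<close>

datatype prog =
    Zero | Succ | Left | Right | Query
  | Pairing prog prog | Comp prog prog | Prec prog prog | Mu prog

primrec run :: "prog \<Rightarrow> (nat \<rightharpoonup> nat) \<Rightarrow> nat \<rightharpoonup> nat" where
  "run Zero Z x = Some 0"
| "run Succ Z x = Some (Suc x)"
| "run Left Z x = Some (fst (prod_decode x))"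
| "run Right Z x = Some (snd (prod_decode x))"
| "run Query Z x = Z x"
| "run (Pairing p q) Z x =
     Option.bind (run p Z x) (\<lambda>a. Option.bind (run q Z x) (\<lambda>b. Some (prod_encode (a, b))))"
| "run (Comp p q) Z x = Option.bind (run q Z x) (run p Z)"
| "run (Prec p q) Z x =
     (case prod_decode x of (a, n) \<Rightarrow>
        rec_nat (run p Z a)
          (\<lambda>m r. Option.bind r (\<lambda>v. run q Z (prod_encode (a, prod_encode (m, v))))) n)"
| "run (Mu p) Z x =
     (if \<exists>n. run p Z (prod_encode (x, n)) = Some 0 \<and>
             (\<forall>m<n. \<exists>v. run p Z (prod_encode (x, m)) = Some (Suc v))
      then Some (LEAST n. run p Z (prod_encode (x, n)) = Some 0)
      else None)"

lemma prod_decode_le: "fst (prod_decode n) \<le> n" "snd (prod_decode n) \<le> n"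
  using le_prod_encode_1 [of "fst (prod_decode n)" "snd (prod_decode n)"]
    le_prod_encode_2 [of "snd (prod_decode n)" "fst (prod_decode n)"]
  by simp_all

text \<open>
  An effective Goedel numbering in which every number is the index of a program.
\<close>

function prog_of :: "nat \<Rightarrow> prog" where
  "prog_of e =
     (if e = 0 then Zero
      else if e = 1 then Succ
      else if e = 2 then Left
      else if e = 3 then Right
      else if e = 4 then Query
      else
        let n = e - 5; a = fst (prod_decode (n div 4)); b = snd (prod_decode (n div 4)) in
          if n mod 4 = 0 then Pairing (prog_of a) (prog_of b)
          else if n mod 4 = 1 then Comp (prog_of a) (prog_of b)
          else if n mod 4 = 2 then Prec (prog_of a) (prog_of b)
          else Mu (prog_of (n div 4)))"
  by auto
termination
proof (relation "measure id", goal_cases)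
  case 1
  show ?case by simp
qed (auto intro!: le_less_trans [OF prod_decode_le(1)] le_less_trans [OF prod_decode_le(2)])

declare prog_of.simps [simp del]

lemma surj_prog_of: "surj prog_of"
proof -
  have div_mod_4: "Suc (4 * n) div 4 = n" "Suc (Suc (4 * n)) div 4 = n"
    "Suc (Suc (Suc (4 * n))) div 4 = n" "Suc (Suc (4 * n)) mod 4 = 2"
    "Suc (Suc (Suc (4 * n))) mod 4 = 3" for n :: nat
    by presburger+
  have "\<exists>e. prog_of e = p" for p
  proof (induction p)
    case Zero
    show ?case by (rule exI [of _ 0]) (simp add: prog_of.simps)
  next
    case Succ
    show ?case by (rule exI [of _ 1]) (simp add: prog_of.simps)
  next
    case Left
    show ?case by (rule exI [of _ 2]) (simp add: prog_of.simps)
  next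
    case Right
    show ?case by (rule exI [of _ 3]) (simp add: prog_of.simps)
  next
    case Query
    show ?case by (rule exI [of _ 4]) (simp add: prog_of.simps)
  next
    case (Pairing p q)
    then obtain a b where "prog_of a = p" "prog_of b = q" by blast
    then show ?case
      by (intro exI [of _ "5 + 4 * prod_encode (a, b)"]) (subst prog_of.simps, simp)
  next
    case (Comp p q)
    then obtain a b where "prog_of a = p" "prog_of b = q" by blast
    then show ?case
      by (intro exI [of _ "5 + (4 * prod_encode (a, b) + 1)"]) (subst prog_of.simps, simp add: div_mod_4)
  next
    case (Prec p q)
    then obtain a b where "prog_of a = p" "prog_of b = q" by blast
    then show ?case
      by (intro exI [of _ "5 + (4 * prod_encode (a, b) + 2)"]) (subst prog_of.simps, simp add: Let_def div_mod_4)
  next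
    case (Mu p)
    then obtain a where "prog_of a = p" by blast
    then show ?case
      by (intro exI [of _ "5 + (4 * a + 3)"]) (subst prog_of.simps, simp add: Let_def div_mod_4)
  qed
  then show ?thesis
    by (metis surj_def)
qed

definition Phi :: "nat \<Rightarrow> (nat \<rightharpoonup> nat) \<Rightarrow> nat \<rightharpoonup> nat" where
  "Phi e Z = run (prog_of e) Z"

definition char_fun :: "nat set \<Rightarrow> nat \<rightharpoonup> nat" where
  "char_fun X n = Some (if n \<in> X then 1 else 0)"

definition partial_computable_in :: "nat set \<Rightarrow> (nat \<rightharpoonup> nat) \<Rightarrow> bool" where
  "partial_computable_in X f \<longleftrightarrow> (\<exists>e. f = Phi e (char_fun X))"

definition ce :: "nat set \<Rightarrow> bool" where
  "ce A \<longleftrightarrow> (\<exists>f. partial_computable_in {} f \<and> A = dom f)"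

definition set_join :: "nat set \<Rightarrow> nat set \<Rightarrow> nat set" where
  "set_join X Y = {2 * n | n. n \<in> X} \<union> {2 * n + 1 | n. n \<in> Y}"

definition fun_join :: "(nat \<rightharpoonup> nat) \<Rightarrow> (nat \<rightharpoonup> nat) \<Rightarrow> nat \<rightharpoonup> nat" where
  "fun_join f g n = (if even n then f (n div 2) else g (n div 2))"

section \<open>Partial applicative systems\<close>

record 'a pas =
  dom_of :: "'a set"
  app :: "'a \<Rightarrow> 'a \<Rightarrow> 'a option"

definition weak_embedding :: "'a pas \<Rightarrow> 'b pas \<Rightarrow> ('a \<Rightarrow> 'b) \<Rightarrow> bool" where
  "weak_embedding A C F \<longleftrightarrow>
     F ` dom_of A \<subseteq> dom_of C \<and> inj_on F (dom_of A) \<and>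
     (\<forall>a \<in> dom_of A. \<forall>b \<in> dom_of A. \<forall>c. app A a b = Some c \<longrightarrow> app C (F a) (F b) = Some (F c))"

definition weakly_embeds :: "'a pas \<Rightarrow> 'b pas \<Rightarrow> bool" where
  "weakly_embeds A C \<longleftrightarrow> (\<exists>F. weak_embedding A C F)"

definition graph_app :: "nat set \<Rightarrow> nat set \<Rightarrow> nat set" where
  "graph_app A B = {n. \<exists>u. prod_encode (n, u) \<in> A \<and> set_decode u \<subseteq> B}"

inductive_set graph_dom :: "nat set \<Rightarrow> nat set set" for Z where
  generator: "Z \<in> graph_dom Z"
| ce: "ce A \<Longrightarrow> A \<in> graph_dom Z"
| app: "A \<in> graph_dom Z \<Longrightarrow> B \<in> graph_dom Z \<Longrightarrow> graph_app A B \<in> graph_dom Z"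

definition graph_model :: "nat set \<Rightarrow> nat set pas" where
  "graph_model Z = \<lparr>dom_of = graph_dom Z, app = (\<lambda>A B. Some (graph_app A B))\<rparr>"

text \<open>
  Application is total: if \<open>f 0\<close> is undefined, the result is the nowhere defined function.
\<close>

definition B_app :: "(nat \<rightharpoonup> nat) \<Rightarrow> (nat \<rightharpoonup> nat) \<Rightarrow> nat \<rightharpoonup> nat" where
  "B_app f g n = Option.bind (f 0) (\<lambda>e. Phi e (fun_join f g) n)"

definition B_model :: "nat set \<Rightarrow> (nat \<rightharpoonup> nat) pas" where
  "B_model X = \<lparr>dom_of = {f. partial_computable_in X f}, app = (\<lambda>f g. Some (B_app f g))\<rparr>"

end

theory Submission
  imports Defs
begin

text \<open>
  Suppose \<open>F\<close> embeds the graph model. Iterating the successor on singletons makes the functions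
  \<open>F {n}\<close> uniformly \<open>X\<close>-computable. For finite \<open>A \<subseteq> B\<close> there is an element \<open>k\<close> with \<open>k \<cdot> {n} = B\<close> if
  \<open>n\<close> lies in the halting problem of \<open>X\<close>, and \<open>k \<cdot> {n} = A\<close> otherwise. As the complement of the
  halting problem is not \<open>X\<close>-c.e., it follows that \<open>F A\<close> is a restriction of \<open>F B\<close>. So \<open>F\<close> is
  monotone on finite sets, and the images of finite sets are compatible functions.

  Oracle computations are sequential: if a computation converges on two compatible oracles, it makes
  the same queries to both, and converges on their intersection. Take \<open>A1\<close> and \<open>A2\<close> with
  \<open>A1 \<cdot> {0} = A2 \<cdot> {1} = {0}\<close> and \<open>A1 \<cdot> {1} = {}\<close>. Wherever \<open>F {0}\<close> is defined, the computations of
  \<open>F A1 \<cdot> F {0}\<close> and \<open>F A2 \<cdot> F {1}\<close> converge, hence so does that of \<open>F A1 \<cdot> F {1} = F {}\<close>. Thus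
  \<open>F {} = F {0}\<close>, contradicting injectivity.
\<close>

section \<open>Stability and continuity of functionals\<close>

text \<open>Agreeing answers force both computations to make the same queries in the same order, and
  \<open>Z\<close> knows every answer on which they agree. So \<open>Z\<close> need only extend the
  intersection of \<open>Z1\<close> and \<open>Z2\<close>. Taking \<open>Z1 = Z2\<close> gives
  monotonicity.\<close>

lemma run_stable:
  assumes "\<And>q a b. Z1 q = Some a \<Longrightarrow> Z2 q = Some b \<Longrightarrow> a = b \<and> Z q = Some a"
  shows "run p Z1 x = Some v \<Longrightarrow> run p Z2 x = Some w \<Longrightarrow> v = w \<and> run p Z x = Some v"
proof (induction p arbitrary: x v w)
  case Query
  then show ?case using assms by simp
next
  case (Pairing p q)
  then show ?case by (fastforce simp: bind_eq_Some_conv)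
next
  case (Comp p q)
  then show ?case by (fastforce simp: bind_eq_Some_conv)
next
  case (Prec p q)
  obtain a n where x: "prod_decode x = (a, n)" by force
  let ?r = "\<lambda>Y. rec_nat (run p Y a)
    (\<lambda>m r. Option.bind r (\<lambda>v. run q Y (prod_encode (a, prod_encode (m, v)))))"
  have "?r Z1 n = Some v \<Longrightarrow> ?r Z2 n = Some w \<Longrightarrow> v = w \<and> ?r Z n = Some v" for v w
  proof (induction n arbitrary: v w)
    case 0
    then show ?case using Prec.IH(1) by simp
  next
    case (Suc n)
    then obtain v' w' where vw: "?r Z1 n = Some v'" "?r Z2 n = Some w'"
      "run q Z1 (prod_encode (a, prod_encode (n, v'))) = Some v"
      "run q Z2 (prod_encode (a, prod_encode (n, w'))) = Some w"
      by (auto simp: bind_eq_Some_conv)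
    have "v' = w' \<and> ?r Z n = Some v'" using Suc.IH vw by blast
    then show ?case using Prec.IH(2) vw by auto
  qed
  then show ?case using Prec.prems x by simp
next
  case (Mu p)
  let ?f = "\<lambda>Y n. run p Y (prod_encode (x, n))"
  let ?c = "\<lambda>Y n. ?f Y n = Some 0 \<and> (\<forall>m<n. \<exists>v. ?f Y m = Some (Suc v))"
  have least: "(LEAST n. ?f Y n = Some 0) = n" if "?c Y n" for Y n
    using that by (intro Least_equality) (auto simp: not_less[symmetric])
  have halt: "?c Y u" if "run (Mu p) Y x = Some u" for Y u
    using that least by (auto split: if_splits)
  have v: "?c Z1 v" and w: "?c Z2 w" using halt Mu.prems by blast+
  have agree: "?f Z1 n = Some a \<Longrightarrow> ?f Z2 n = Some b \<Longrightarrow> a = b \<and> ?f Z n = Some a" for n a b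
    using Mu.IH by blast
  \<comment> \<open>At the smaller of two distinct values one oracle would give 0 and the other a
    successor.\<close>
  have "v = w"
    using v w agree by (metis linorder_neqE_nat nat.distinct(1))
  have "?c Z v"
  proof (intro conjI allI impI)
    show "?f Z v = Some 0" using agree v w \<open>v = w\<close> by blast
    fix m assume "m < v"
    then obtain a b where "?f Z1 m = Some (Suc a)" "?f Z2 m = Some (Suc b)"
      using v w \<open>v = w\<close> by blast
    then show "\<exists>v. ?f Z m = Some (Suc v)" using agree by blast
  qed
  then show ?case using least \<open>v = w\<close> by auto
qed simp_all

lemma run_mono: "run p Y x = Some v \<Longrightarrow> Y \<subseteq>\<^sub>m Z \<Longrightarrow> run p Z x = Some v"
  using run_stable[of Y Y Z] by (auto simp: map_le_def dom_def)

lemma restrict_map_mono: "D \<subseteq> E \<Longrightarrow> Z |` D \<subseteq>\<^sub>m Z |` E"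
  by (auto simp: map_le_def restrict_map_def)

text \<open>The use principle: uses of subcomputations are united, and monotonicity lifts each of
  them to the union. It later turns \<open>X\<close>-computations into enumerations from finite
  information about \<open>X\<close>.\<close>

lemma run_finite_use:
  "run p Z x = Some v \<Longrightarrow> \<exists>D. finite D \<and> run p (Z |` D) x = Some v"
proof (induction p arbitrary: x v)
  case Query
  then show ?case by (intro exI[of _ "{x}"]) simp
next
  case (Pairing p q)
  then obtain a b where ab: "run p Z x = Some a" "run q Z x = Some b" "v = prod_encode (a, b)"
    by (auto simp: bind_eq_Some_conv)
  obtain D E where "finite D" "run p (Z |` D) x = Some a" "finite E" "run q (Z |` E) x = Some b"
    using Pairing.IH ab by meson
  then show ?case using ab
    by (intro exI[of _ "D \<union> E"])
      (auto simp: bind_eq_Some_conv intro: run_mono[OF _ restrict_map_mono])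
next
  case (Comp p q)
  then obtain a where a: "run q Z x = Some a" "run p Z a = Some v"
    by (auto simp: bind_eq_Some_conv)
  obtain D E where "finite D" "run q (Z |` D) x = Some a" "finite E" "run p (Z |` E) a = Some v"
    using Comp.IH a by meson
  then show ?case
    by (intro exI[of _ "D \<union> E"])
      (auto simp: bind_eq_Some_conv intro!: exI[of _ a] intro: run_mono[OF _ restrict_map_mono])
next
  case (Prec p q)
  obtain a n where x: "prod_decode x = (a, n)" by force
  let ?r = "\<lambda>Y. rec_nat (run p Y a)
    (\<lambda>m r. Option.bind r (\<lambda>v. run q Y (prod_encode (a, prod_encode (m, v)))))"
  have "?r Z n = Some v \<Longrightarrow> \<exists>D. finite D \<and> ?r (Z |` D) n = Some v" for v
  proof (induction n arbitrary: v)
    case 0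
    then show ?case using Prec.IH(1) by simp
  next
    case (Suc n)
    then obtain u where u: "?r Z n = Some u"
      "run q Z (prod_encode (a, prod_encode (n, u))) = Some v"
      by (auto simp: bind_eq_Some_conv)
    obtain D E where D: "finite D" "?r (Z |` D) n = Some u" and
      E: "finite E" "run q (Z |` E) (prod_encode (a, prod_encode (n, u))) = Some v"
      using Suc.IH Prec.IH(2) u by meson
    \<comment> \<open>The recursor is folded back into a program so that \<open>run_mono\<close>
      applies to it.\<close>
    have "run (Prec p q) (Z |` D) (prod_encode (a, n)) = Some u" using D by simp
    then have "run (Prec p q) (Z |` (D \<union> E)) (prod_encode (a, n)) = Some u"
      by (rule run_mono[OF _ restrict_map_mono]) simp
    moreover have "run q (Z |` (D \<union> E)) (prod_encode (a, prod_encode (n, u))) = Some v"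
      using E(2) by (rule run_mono[OF _ restrict_map_mono]) simp
    ultimately show ?case using D E by (intro exI[of _ "D \<union> E"]) simp
  qed
  then show ?case using Prec.prems x by simp
next
  case (Mu p)
  let ?f = "\<lambda>Y n. run p Y (prod_encode (x, n))"
  have least: "(LEAST n. ?f Y n = Some 0) = n"
    if "?f Y n = Some 0" "\<forall>m<n. \<exists>v. ?f Y m = Some (Suc v)" for Y n
    using that by (intro Least_equality) (auto simp: not_less[symmetric])
  have v: "?f Z v = Some 0" "\<forall>m<v. \<exists>u. ?f Z m = Some (Suc u)"
    using Mu.prems least by (auto split: if_splits)
  \<comment> \<open>The search evaluates \<open>p\<close> at the arguments up to \<open>v\<close>
    only, so finitely many uses suffice.\<close>
  have "\<forall>m. \<exists>D. m \<le> v \<longrightarrow> finite D \<and> ?f (Z |` D) m = ?f Z m"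
    using Mu.IH v by (metis le_neq_implies_less)
  then obtain D where D: "\<And>m. m \<le> v \<Longrightarrow> finite (D m) \<and> ?f (Z |` D m) m = ?f Z m"
    by metis
  let ?D = "\<Union>m\<le>v. D m"
  have eq: "?f (Z |` ?D) m = ?f Z m" if mv: "m \<le> v" for m
  proof -
    obtain a where "?f (Z |` D m) m = Some a" "?f Z m = Some a"
      using v D mv by (metis le_neq_implies_less)
    moreover from this have "?f (Z |` ?D) m = Some a"
      using mv by (auto intro: run_mono[OF _ restrict_map_mono[of "D m"]])
    ultimately show ?thesis by simp
  qed
  then have "?f (Z |` ?D) v = Some 0" "\<forall>m<v. \<exists>u. ?f (Z |` ?D) m = Some (Suc u)"
    using v by auto
  then have "run (Mu p) (Z |` ?D) x = Some v"
    using least[of "Z |` ?D" v] by auto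
  then show ?case using D by blast
qed auto

section \<open>Closure properties of relative computability\<close>

abbreviation pfst :: "nat \<Rightarrow> nat" where "pfst n \<equiv> fst (prod_decode n)"
abbreviation psnd :: "nat \<Rightarrow> nat" where "psnd n \<equiv> snd (prod_decode n)"
abbreviation pair :: "nat \<Rightarrow> nat \<Rightarrow> nat" where "pair a b \<equiv> prod_encode (a, b)"

definition pcomp :: "(nat \<rightharpoonup> nat) \<Rightarrow> (nat \<rightharpoonup> nat) \<Rightarrow> bool" where
  "pcomp Z f \<longleftrightarrow> (\<exists>p. run p Z = f)"

definition tcomp :: "(nat \<rightharpoonup> nat) \<Rightarrow> (nat \<Rightarrow> nat) \<Rightarrow> bool" where
  "tcomp Z f \<longleftrightarrow> pcomp Z (\<lambda>s. Some (f s))"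

text \<open>Truth is coded by 0, so the value serves directly as the test of \<open>Mu\<close> and
  as a recursion length of 0 or 1.\<close>

definition decidable :: "(nat \<rightharpoonup> nat) \<Rightarrow> (nat \<Rightarrow> bool) \<Rightarrow> bool" where
  "decidable Z P \<longleftrightarrow> tcomp Z (\<lambda>s. if P s then 0 else 1)"

lemma pcompI: "(\<And>x. run p Z x = f x) \<Longrightarrow> pcomp Z f"
  by (auto simp: pcomp_def)

lemma tcompI: "(\<And>x. run p Z x = Some (f x)) \<Longrightarrow> tcomp Z f"
  unfolding tcomp_def by (rule pcompI)

lemma tcomp_iff: "tcomp Z f \<longleftrightarrow> (\<exists>p. \<forall>x. run p Z x = Some (f x))"
  by (auto simp: tcomp_def pcomp_def fun_eq_iff)

lemma pcomp_Some: "tcomp Z f \<Longrightarrow> pcomp Z (\<lambda>s. Some (f s))"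
  by (simp add: tcomp_def)

lemma tcomp_id: "tcomp Z (\<lambda>s. s)"
  by (rule tcompI[of "Pairing Left Right"]) simp

lemma pcomp_compose:
  assumes "pcomp Z f" "tcomp Z g" shows "pcomp Z (\<lambda>s. f (g s))"
proof -
  obtain p where "run p Z = f" using assms by (auto simp: pcomp_def)
  moreover obtain q where "\<And>x. run q Z x = Some (g x)" using assms by (auto simp: tcomp_iff)
  ultimately show ?thesis by (intro pcompI[of "Comp p q"]) simp
qed

lemma tcomp_compose: "tcomp Z f \<Longrightarrow> tcomp Z g \<Longrightarrow> tcomp Z (\<lambda>s. f (g s))"
  unfolding tcomp_def by (rule pcomp_compose) (simp_all add: tcomp_def)

lemma tcomp_const: "tcomp Z (\<lambda>s. c)"
proof (induction c)
  case 0
  show ?case by (rule tcompI[of Zero]) simp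
next
  case (Suc c)
  then obtain p where "\<And>x. run p Z x = Some c" by (auto simp: tcomp_iff)
  then show ?case by (intro tcompI[of "Comp Succ p"]) simp
qed

lemma tcomp_Suc: "tcomp Z f \<Longrightarrow> tcomp Z (\<lambda>s. Suc (f s))"
  by (rule tcomp_compose[of Z Suc]) (auto intro: tcompI[of Succ])

lemma tcomp_pfst: "tcomp Z f \<Longrightarrow> tcomp Z (\<lambda>s. pfst (f s))"
  by (rule tcomp_compose[of Z pfst]) (auto intro: tcompI[of Left])

lemma tcomp_psnd: "tcomp Z f \<Longrightarrow> tcomp Z (\<lambda>s. psnd (f s))"
  by (rule tcomp_compose[of Z psnd]) (auto intro: tcompI[of Right])

lemma tcomp_pair:
  assumes "tcomp Z f" "tcomp Z g" shows "tcomp Z (\<lambda>s. pair (f s) (g s))"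
proof -
  obtain p q where "\<And>x. run p Z x = Some (f x)" "\<And>x. run q Z x = Some (g x)"
    using assms by (metis tcomp_iff)
  then show ?thesis by (intro tcompI[of "Pairing p q"]) simp
qed

text \<open>Programs are unary, so computability of a function with a parameter is expressed through
  the projections of a coded pair. The later closure rules follow the same convention.\<close>

lemma pcomp_bind:
  assumes "pcomp Z f" "pcomp Z (\<lambda>z. g (pfst z) (psnd z))"
  shows "pcomp Z (\<lambda>s. Option.bind (f s) (g s))"
proof -
  obtain p q where "run p Z = f" "run q Z = (\<lambda>z. g (pfst z) (psnd z))"
    using assms by (auto simp: pcomp_def)
  then show ?thesis
    by (intro pcompI[of "Comp q (Pairing (Pairing Left Right) p)"])
      (auto split: Option.bind_split)
qed

lemma pcomp_rec:
  assumes "pcomp Z g" "pcomp Z (\<lambda>z. h (pfst z) (pfst (psnd z)) (psnd (psnd z)))" "tcomp Z n"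
  shows "pcomp Z (\<lambda>s. rec_nat (g s) (\<lambda>m r. Option.bind r (h s m)) (n s))"
proof -
  obtain p q k where "\<And>x. run p Z x = g x" "\<And>z. run q Z z = h (pfst z) (pfst (psnd z)) (psnd (psnd z))"
    "\<And>x. run k Z x = Some (n x)"
    using assms unfolding pcomp_def tcomp_iff fun_eq_iff by metis
  then show ?thesis
    by (intro pcompI[of "Comp (Prec p q) (Pairing (Pairing Left Right) k)"]) simp
qed

lemma pcomp_mu:
  assumes "pcomp Z (\<lambda>z. f (pfst z) (psnd z))"
  shows "pcomp Z (\<lambda>s. if \<exists>n. f s n = Some 0 \<and> (\<forall>m<n. \<exists>v. f s m = Some (Suc v))
    then Some (LEAST n. f s n = Some 0) else None)"
proof -
  obtain p where "run p Z = (\<lambda>z. f (pfst z) (psnd z))" using assms by (auto simp: pcomp_def)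
  then show ?thesis by (intro pcompI[of "Mu p"]) simp
qed

lemma tcomp_rec:
  assumes "tcomp Z g" "tcomp Z (\<lambda>z. h (pfst z) (pfst (psnd z)) (psnd (psnd z)))" "tcomp Z n"
  shows "tcomp Z (\<lambda>s. rec_nat (g s) (h s) (n s))"
proof -
  have "rec_nat (Some a) (\<lambda>m r. Option.bind r (\<lambda>v. Some (k m v))) n = Some (rec_nat a k n)"
    for a :: nat and k and n :: nat
    by (induction n) auto
  then show ?thesis
    using pcomp_rec[of Z "\<lambda>s. Some (g s)" "\<lambda>s m v. Some (h s m v)" n] assms
    by (simp add: tcomp_def)
qed

section \<open>Definition by cases and Boolean combinations\<close>

lemma tcomp_if:
  assumes "decidable Z P" "tcomp Z f" "tcomp Z g"
  shows "tcomp Z (\<lambda>s. if P s then f s else g s)"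
proof -
  have rec: "tcomp Z (\<lambda>s. rec_nat (f s) (\<lambda>m r. g s) (if P s then 0 else 1))"
    using assms(1)
    by (intro tcomp_rec assms tcomp_compose[OF assms(3)] tcomp_pfst tcomp_id)
      (simp add: decidable_def)
  have eq: "(\<lambda>s. rec_nat (f s) (\<lambda>m r. g s) (if P s then 0 else 1)) = (\<lambda>s. if P s then f s else g s)"
    by auto
  show ?thesis using rec unfolding eq .
qed

lemma pcomp_if:
  assumes "decidable Z P" "pcomp Z f" "pcomp Z g"
  shows "pcomp Z (\<lambda>s. if P s then f s else g s)"
proof -
  have dec: "tcomp Z (\<lambda>s. if P s then 0 else 1)" "tcomp Z (\<lambda>s. if P s then 1 else 0)"
    using assms(1) by (simp_all add: tcomp_if tcomp_const)
  \<comment> \<open>All constructs being strict, a branch is guarded by a recursion of length 0 or 1.\<close>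
  let ?h = "\<lambda>s. Option.bind
    (rec_nat (Some 0) (\<lambda>m r. Option.bind r (\<lambda>v. g s)) (if P s then 0 else 1))
    (\<lambda>y. rec_nat (Some y) (\<lambda>m r. Option.bind r (\<lambda>v. f s)) (if P s then 1 else 0))"
  have "pcomp Z ?h"
    by (intro pcomp_bind pcomp_rec pcomp_Some tcomp_const dec tcomp_psnd tcomp_pfst tcomp_id
        pcomp_compose[OF assms(2)] pcomp_compose[OF assms(3)] tcomp_compose[OF dec(2)])
  moreover have "?h = (\<lambda>s. if P s then f s else g s)"
    by (rule ext) (auto split: Option.bind_split)
  ultimately show ?thesis by simp
qed

lemma decidable_compose: "decidable Z P \<Longrightarrow> tcomp Z f \<Longrightarrow> decidable Z (\<lambda>s. P (f s))"
  unfolding decidable_def by (rule tcomp_compose)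

lemma decidable_const: "decidable Z (\<lambda>s. b)"
  unfolding decidable_def by (rule tcomp_const)

lemma decidable_conj:
  assumes "decidable Z P" "decidable Z Q" shows "decidable Z (\<lambda>s. P s \<and> Q s)"
proof -
  have "tcomp Z (\<lambda>s. if P s then if Q s then 0 else 1 else 1)"
    by (intro tcomp_if assms tcomp_const)
  moreover have "(\<lambda>s. if P s then if Q s then 0 else 1 else 1) = (\<lambda>s. if P s \<and> Q s then 0 else 1 :: nat)"
    by auto
  ultimately show ?thesis by (simp add: decidable_def)
qed

lemma decidable_not:
  assumes "decidable Z P" shows "decidable Z (\<lambda>s. \<not> P s)"
proof -
  have "tcomp Z (\<lambda>s. if P s then 1 else 0)" by (intro tcomp_if assms tcomp_const)
  moreover have "(\<lambda>s. if P s then 1 else 0) = (\<lambda>s. if \<not> P s then 0 else 1 :: nat)" by auto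
  ultimately show ?thesis by (simp add: decidable_def)
qed

lemma decidable_disj:
  assumes "decidable Z P" "decidable Z Q" shows "decidable Z (\<lambda>s. P s \<or> Q s)"
  using decidable_not[OF decidable_conj[OF decidable_not decidable_not], OF assms] by simp

lemma decidable_imp:
  assumes "decidable Z P" "decidable Z Q" shows "decidable Z (\<lambda>s. P s \<longrightarrow> Q s)"
  unfolding imp_conv_disj by (intro decidable_disj decidable_not assms)

lemma decidable_eq_0:
  assumes "tcomp Z f" shows "decidable Z (\<lambda>s. f s = 0)"
proof -
  have "tcomp Z (\<lambda>s. rec_nat 0 (\<lambda>m r. 1) (f s))"
    by (intro tcomp_rec tcomp_const assms)
  moreover have "rec_nat 0 (\<lambda>m r. 1) n = (if n = 0 then 0 else 1 :: nat)" for n :: nat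
    by (cases n) auto
  ultimately show ?thesis by (simp add: decidable_def)
qed

section \<open>Arithmetic, comparison and bounded quantifiers\<close>

lemma tcomp_add:
  assumes "tcomp Z f" "tcomp Z g" shows "tcomp Z (\<lambda>s. f s + g s)"
proof -
  have "tcomp Z (\<lambda>s. rec_nat (f s) (\<lambda>m r. Suc r) (g s))"
    by (intro tcomp_rec tcomp_Suc tcomp_psnd tcomp_id assms)
  moreover have "rec_nat a (\<lambda>m r. Suc r) b = a + b" for a b :: nat
    by (induction b) auto
  ultimately show ?thesis by simp
qed

lemma tcomp_diff:
  assumes "tcomp Z f" "tcomp Z g" shows "tcomp Z (\<lambda>s. f s - g s)"
proof -
  have pred: "tcomp Z (\<lambda>s. rec_nat 0 (\<lambda>m r. m) (h s))" if "tcomp Z h" for h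
    by (intro tcomp_rec tcomp_const tcomp_pfst tcomp_psnd tcomp_id that)
  have "tcomp Z (\<lambda>s. rec_nat (f s) (\<lambda>m r. rec_nat 0 (\<lambda>m r. m) r) (g s))"
    by (intro tcomp_rec[of Z f "\<lambda>s m r. rec_nat 0 (\<lambda>m r. m) r"] pred tcomp_psnd tcomp_id assms)
  moreover have "rec_nat 0 (\<lambda>m r. m) n = n - 1" for n :: nat
    by (cases n) auto
  moreover have "rec_nat a (\<lambda>m r. r - 1) b = a - b" for a b :: nat
    by (induction b) auto
  ultimately show ?thesis by simp
qed

lemma decidable_less:
  assumes "tcomp Z f" "tcomp Z g" shows "decidable Z (\<lambda>s. f s < g s)"
  using decidable_eq_0[OF tcomp_diff[OF tcomp_Suc[OF assms(1)] assms(2)]]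
  by (simp add: Suc_le_eq)

lemma decidable_eq:
  assumes "tcomp Z f" "tcomp Z g" shows "decidable Z (\<lambda>s. f s = g s)"
  using decidable_conj[OF decidable_not[OF decidable_less[OF assms]]
      decidable_not[OF decidable_less[OF assms(2,1)]]]
  by (simp add: not_less eq_iff conj_commute)

lemma decidable_bex:
  assumes "tcomp Z b" "decidable Z (\<lambda>z. P (pfst z) (psnd z))"
  shows "decidable Z (\<lambda>s. \<exists>y<b s. P s y)"
proof -
  have "tcomp Z (\<lambda>z. if P (pfst z) (pfst (psnd z)) then 0 else psnd (psnd z))"
    using decidable_compose[OF assms(2), of "\<lambda>z. pair (pfst z) (pfst (psnd z))"]
    by (simp add: tcomp_if tcomp_pair tcomp_const tcomp_pfst tcomp_psnd tcomp_id)
  then have "tcomp Z (\<lambda>s. rec_nat 1 (\<lambda>m r. if P s m then 0 else r) (b s))"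
    by (intro tcomp_rec tcomp_const assms(1))
  moreover have "rec_nat (1 :: nat) (\<lambda>m r. if P s m then 0 else r) n = (if \<exists>y<n. P s y then 0 else 1)"
    for s n
    by (induction n) (auto simp: less_Suc_eq)
  ultimately show ?thesis by (simp add: decidable_def)
qed

lemma decidable_ball:
  assumes "tcomp Z b" "decidable Z (\<lambda>z. P (pfst z) (psnd z))"
  shows "decidable Z (\<lambda>s. \<forall>y<b s. P s y)"
  using decidable_not[OF decidable_bex[OF assms(1) decidable_not[OF assms(2)]]] by simp

section \<open>Unbounded search, halving and coded finite sets\<close>

lemma pcomp_search:
  assumes "decidable Z (\<lambda>z. P (pfst z) (psnd z))"
  shows "pcomp Z (\<lambda>s. if \<exists>n. P s n then Some (LEAST n. P s n) else None)"
proof -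
  let ?f = "\<lambda>s n. Some (if P s n then 0 else 1 :: nat)"
  have "pcomp Z (\<lambda>z. ?f (pfst z) (psnd z))"
    using assms by (simp add: decidable_def tcomp_def)
  note mu = pcomp_mu[OF this]
  have flag: "(if b then 0 else Suc 0) = 0 \<longleftrightarrow> b" for b
    by simp
  have "(\<exists>n. ?f s n = Some 0 \<and> (\<forall>m<n. \<exists>v. ?f s m = Some (Suc v))) \<longleftrightarrow> (\<exists>n. P s n)" for s
    by (auto simp: exists_least_iff[of "P s"])
  then show ?thesis using mu by (simp add: flag cong: if_cong)
qed

lemma tcomp_Least:
  assumes "decidable Z (\<lambda>z. P (pfst z) (psnd z))" "\<And>s. \<exists>n. P s n"
  shows "tcomp Z (\<lambda>s. LEAST n. P s n)"
  using pcomp_search[OF assms(1)] assms(2) by (simp add: tcomp_def)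

lemma tcomp_half:
  assumes "tcomp Z f" shows "tcomp Z (\<lambda>s. f s div 2)"
proof (rule tcomp_compose[OF _ assms])
  \<comment> \<open>Doubling is written as a sum so that \<open>tcomp_add\<close> applies.\<close>
  have "tcomp Z (\<lambda>s. LEAST n. s < n + n + 2)"
    by (rule tcomp_Least)
      (intro decidable_less tcomp_add tcomp_pfst tcomp_psnd tcomp_id tcomp_const, presburger)
  moreover have "(LEAST n. s < n + n + 2) = s div 2" for s :: nat
    by (rule Least_equality) linarith+
  ultimately show "tcomp Z (\<lambda>s. s div 2)" by simp
qed

lemma decidable_even:
  assumes "tcomp Z f" shows "decidable Z (\<lambda>s. even (f s))"
proof -
  have "decidable Z (\<lambda>s. f s = f s div 2 + f s div 2)"
    by (intro decidable_eq tcomp_add tcomp_half assms)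
  moreover have "n = n div 2 + n div 2 \<longleftrightarrow> even n" for n :: nat
    by presburger
  ultimately show ?thesis by simp
qed

lemma decidable_set_decode:
  assumes "tcomp Z f" "tcomp Z g" shows "decidable Z (\<lambda>s. f s \<in> set_decode (g s))"
proof -
  \<comment> \<open>Membership is a bit test: after \<open>f s\<close> halvings the bit in question
    is the last one.\<close>
  have "decidable Z (\<lambda>s. \<not> even (rec_nat (g s) (\<lambda>m r. r div 2) (f s)))"
    by (intro decidable_not decidable_even tcomp_rec tcomp_half tcomp_psnd tcomp_id assms)
  moreover have "rec_nat a (\<lambda>m r. r div 2) b = a div 2 ^ b" for a b :: nat
    by (induction b) (auto simp: div_mult2_eq[symmetric] mult.commute)
  ultimately show ?thesis by (simp add: set_decode_def)
qed

lemmas tcomp_intros = tcomp_id tcomp_const tcomp_pair tcomp_pfst tcomp_psnd tcomp_Suc tcomp_add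

lemmas decidable_intros = decidable_conj decidable_disj decidable_not decidable_imp
  decidable_eq decidable_less decidable_bex decidable_ball decidable_set_decode

text \<open>Each \<open>Query\<close> is replaced by a computation of the oracle
  \<open>Y (pfst z)\<close> from \<open>Z\<close>, and all other constructs are already closed. The
  oracle may be partial and varies with the parameter, as in \<open>B_app\<close> with a varying
  argument or with finite oracles given by codes.\<close>

lemma pcomp_subst_oracle:
  assumes o: "pcomp Z (\<lambda>z. Y (pfst z) (psnd z))"
  shows "pcomp Z (\<lambda>z. run p (Y (pfst z)) (psnd z))"
proof (induction p)
  case Query
  show ?case using o by simp
next
  case (Pairing p q)
  show ?case unfolding run.simps
    by (intro pcomp_bind Pairing pcomp_compose[OF Pairing(2)] pcomp_Some tcomp_intros)
next
  case (Comp p q)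
  have "pcomp Z (\<lambda>z. run p (Y (pfst (pfst z))) (psnd z))"
    using pcomp_compose[OF Comp(1), of "\<lambda>z. pair (pfst (pfst z)) (psnd z)"]
    by (simp add: tcomp_intros)
  then show ?case unfolding run.simps by (intro pcomp_bind Comp)
next
  case (Prec p q)
  have 1: "pcomp Z (\<lambda>z. run p (Y (pfst z)) (pfst (psnd z)))"
    using pcomp_compose[OF Prec(1), of "\<lambda>z. pair (pfst z) (pfst (psnd z))"]
    by (simp add: tcomp_intros)
  have 2: "pcomp Z (\<lambda>z. run q (Y (pfst (pfst z)))
      (pair (pfst (psnd (pfst z))) (pair (pfst (psnd z)) (psnd (psnd z)))))"
    using pcomp_compose[OF Prec(2), of "\<lambda>z. pair (pfst (pfst z))
      (pair (pfst (psnd (pfst z))) (pair (pfst (psnd z)) (psnd (psnd z))))"]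
    by (simp add: tcomp_intros)
  show ?case
    using pcomp_rec[OF 1, of "\<lambda>z m v. run q (Y (pfst z)) (pair (pfst (psnd z)) (pair m v))"
        "\<lambda>z. psnd (psnd z)"] 2
    by (simp add: tcomp_intros case_prod_beta)
next
  case (Mu p)
  have "pcomp Z (\<lambda>z. run p (Y (pfst (pfst z))) (pair (psnd (pfst z)) (psnd z)))"
    using pcomp_compose[OF Mu, of "\<lambda>z. pair (pfst (pfst z)) (pair (psnd (pfst z)) (psnd z))"]
    by (simp add: tcomp_intros)
  from pcomp_mu[of Z "\<lambda>z n. run p (Y (pfst z)) (pair (psnd z) n)", OF this]
  show ?case by simp
qed (simp_all add: pcomp_Some tcomp_intros)

section \<open>A universal program\<close>

lemma prog_of_Pairing: "prog_of (5 + 4 * c) = Pairing (prog_of (pfst c)) (prog_of (psnd c))"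
  by (subst prog_of.simps) simp

lemma prog_of_Comp: "prog_of (6 + 4 * c) = Comp (prog_of (pfst c)) (prog_of (psnd c))"
proof -
  have "Suc (4 * c) div 4 = c" by presburger
  then show ?thesis by (subst prog_of.simps) (simp add: Let_def)
qed

lemma prog_of_Prec: "prog_of (7 + 4 * c) = Prec (prog_of (pfst c)) (prog_of (psnd c))"
proof -
  have "Suc (Suc (4 * c)) div 4 = c" "Suc (Suc (4 * c)) mod 4 = 2" by presburger+
  then show ?thesis by (subst prog_of.simps) (simp add: Let_def)
qed

lemma prog_of_Mu: "prog_of (8 + 4 * c) = Mu (prog_of c)"
proof -
  have "Suc (Suc (Suc (4 * c))) div 4 = c" "Suc (Suc (Suc (4 * c))) mod 4 = 3" by presburger+
  then show ?thesis by (subst prog_of.simps) (simp add: Let_def)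
qed

lemma prog_of_basic:
  "prog_of 0 = Zero" "prog_of 1 = Succ" "prog_of 2 = Left" "prog_of 3 = Right" "prog_of 4 = Query"
  by (simp_all add: prog_of.simps)

abbreviation triple :: "nat \<Rightarrow> nat \<Rightarrow> nat \<Rightarrow> nat" where
  "triple e x v \<equiv> pair e (pair x v)"

text \<open>
  \<open>justified z D e x v\<close>: the claim that program \<open>e\<close> with oracle \<open>z\<close> maps \<open>x\<close> to \<open>v\<close> follows in one
  step from the claims coded in \<open>D\<close>. Since \<open>run\<close> is structurally recursive, a finite set of claims
  that justifies all of its members contains only true claims, so searching for such a set is a
  universal program.
\<close>

definition justified :: "(nat \<Rightarrow> nat) \<Rightarrow> nat set \<Rightarrow> nat \<Rightarrow> nat \<Rightarrow> nat \<Rightarrow> bool" where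
  "justified z D e x v \<longleftrightarrow>
     e = 0 \<and> v = 0 \<or> e = 1 \<and> v = Suc x \<or> e = 2 \<and> v = pfst x \<or> e = 3 \<and> v = psnd x \<or> e = 4 \<and> v = z x \<or>
     (\<exists>c<e.
       e = 5 + (c + c + c + c) \<and> triple (pfst c) x (pfst v) \<in> D \<and> triple (psnd c) x (psnd v) \<in> D \<or>
       e = 6 + (c + c + c + c) \<and> (\<exists>y. triple (psnd c) x y \<in> D \<and> triple (pfst c) y v \<in> D) \<or>
       e = 7 + (c + c + c + c) \<and>
         (psnd x = 0 \<and> triple (pfst c) (pfst x) v \<in> D \<or>
          (\<exists>m<psnd x. psnd x = Suc m \<and>
            (\<exists>y. triple e (pair (pfst x) m) y \<in> D \<and>
                 triple (psnd c) (pair (pfst x) (pair m y)) v \<in> D))) \<or>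
       e = 8 + (c + c + c + c) \<and> triple c (pair x v) 0 \<in> D \<and>
         (\<forall>m<v. \<exists>y. triple c (pair x m) y \<in> D \<and> \<not> y = 0))"

lemma justified_cases:
  assumes "justified z D e x v"
  obtains "e = 0" "v = 0" | "e = 1" "v = Suc x" | "e = 2" "v = pfst x" | "e = 3" "v = psnd x"
  | "e = 4" "v = z x"
  | (Pairing) c where "e = 5 + 4 * c" "triple (pfst c) x (pfst v) \<in> D"
      "triple (psnd c) x (psnd v) \<in> D"
  | (Comp) c y where "e = 6 + 4 * c" "triple (psnd c) x y \<in> D" "triple (pfst c) y v \<in> D"
  | (Prec0) c where "e = 7 + 4 * c" "psnd x = 0" "triple (pfst c) (pfst x) v \<in> D"
  | (PrecSuc) c m y where "e = 7 + 4 * c" "psnd x = Suc m" "triple e (pair (pfst x) m) y \<in> D"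
      "triple (psnd c) (pair (pfst x) (pair m y)) v \<in> D"
  | (Mu) c where "e = 8 + 4 * c" "triple c (pair x v) 0 \<in> D"
      "\<And>m. m < v \<Longrightarrow> \<exists>y. triple c (pair x m) (Suc y) \<in> D"
proof -
  have 4: "c + c + c + c = 4 * c" for c :: nat by simp
  show ?thesis
    using assms that unfolding justified_def 4
    by (elim disjE conjE exE) (metis not0_implies_Suc)+
qed

lemma justified_PairingI:
  "triple (pfst c) x a \<in> D \<Longrightarrow> triple (psnd c) x b \<in> D \<Longrightarrow> justified z D (5 + 4 * c) x (pair a b)"
  unfolding justified_def by (intro disjI2 exI[of _ c]) auto

lemma justified_CompI:
  "triple (psnd c) x y \<in> D \<Longrightarrow> triple (pfst c) y v \<in> D \<Longrightarrow> justified z D (6 + 4 * c) x v"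
  unfolding justified_def by (intro disjI2 exI[of _ c]) auto

lemma justified_Prec0I:
  "triple (pfst c) a v \<in> D \<Longrightarrow> justified z D (7 + 4 * c) (pair a 0) v"
  unfolding justified_def by (intro disjI2 exI[of _ c]) auto

lemma justified_PrecSucI:
  "triple (7 + 4 * c) (pair a m) y \<in> D \<Longrightarrow> triple (psnd c) (pair a (pair m y)) v \<in> D \<Longrightarrow>
    justified z D (7 + 4 * c) (pair a (Suc m)) v"
  unfolding justified_def by (intro disjI2 exI[of _ c]) auto

lemma justified_MuI:
  "triple c (pair x v) 0 \<in> D \<Longrightarrow> (\<And>m. m < v \<Longrightarrow> \<exists>y. triple c (pair x m) (Suc y) \<in> D) \<Longrightarrow>
    justified z D (8 + 4 * c) x v"
  unfolding justified_def by (intro disjI2 exI[of _ c]) auto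

text \<open>Claims in \<open>D\<close> occur only positively in each clause.\<close>

lemma justified_mono:
  assumes "justified z D e x v" "D \<subseteq> E" shows "justified z E e x v"
  using assms(1)
proof (cases rule: justified_cases)
  case (Pairing c)
  then show ?thesis using justified_PairingI[of c x "pfst v" E "psnd v"] assms(2) by auto
next
  case (Comp c y)
  then show ?thesis using justified_CompI[of c x y E v] assms(2) by blast
next
  case (Prec0 c)
  then have "x = pair (pfst x) 0" by (metis prod.collapse prod_decode_inverse)
  then show ?thesis using Prec0 justified_Prec0I[of c "pfst x" v E] assms(2) by auto
next
  case (PrecSuc c m y)
  then have "x = pair (pfst x) (Suc m)" by (metis prod.collapse prod_decode_inverse)
  then show ?thesis
    using PrecSuc justified_PrecSucI[of c "pfst x" m y E v] assms(2) by (metis subsetD)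
next
  case (Mu c)
  then show ?thesis using justified_MuI[of c x v E] assms(2) by blast
qed (simp_all add: justified_def)

definition coherent :: "(nat \<Rightarrow> nat) \<Rightarrow> nat set \<Rightarrow> bool" where
  "coherent z D \<longleftrightarrow> (\<forall>t\<in>D. justified z D (pfst t) (pfst (psnd t)) (psnd (psnd t)))"

lemma coherentD: "coherent z D \<Longrightarrow> triple e x v \<in> D \<Longrightarrow> justified z D e x v"
  unfolding coherent_def by fastforce

lemma run_Mu_eqI:
  assumes "run p Z (pair x n) = Some 0" "\<And>m. m < n \<Longrightarrow> \<exists>v. run p Z (pair x m) = Some (Suc v)"
  shows "run (Mu p) Z x = Some n"
proof -
  have "(LEAST n. run p Z (pair x n) = Some 0) = n"
    using assms by (intro Least_equality) (fastforce simp: not_less[symmetric])+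
  then show ?thesis using assms by auto
qed

text \<open>Justifications cannot be circular: a claim about \<open>e\<close> rests on claims about
  smaller indices, or, for \<open>Prec\<close>, on a claim about \<open>e\<close> with a smaller
  recursion argument.\<close>

lemma coherent_sound:
  assumes "coherent z D"
  shows "triple e x v \<in> D \<Longrightarrow> run (prog_of e) (\<lambda>n. Some (z n)) x = Some v"
proof (induction e arbitrary: x v rule: less_induct)
  case (less e)
  let ?Z = "\<lambda>n. Some (z n)"
  have smaller: "pfst c < 5 + 4 * c" "psnd c < 5 + 4 * c" for c
    using prod_decode_le[of c] by linarith+
  have Prec: "run (prog_of e) ?Z x = Some v" if e: "e = 7 + 4 * c" for c
  proof -
    have IH: "run (prog_of (pfst c)) ?Z y = Some w" if "triple (pfst c) y w \<in> D" for y w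
      using less.IH smaller[of c] that e by simp
    have IH': "run (prog_of (psnd c)) ?Z y = Some w" if "triple (psnd c) y w \<in> D" for y w
      using less.IH smaller[of c] that e by simp
    \<comment> \<open>The premise for \<open>Suc n\<close> has the same index \<open>e\<close>,
      which the outer induction does not reach. Hence an inner induction on the recursion
      argument.\<close>
    have "triple e (pair a n) w \<in> D \<Longrightarrow> run (prog_of e) ?Z (pair a n) = Some w" for a n w
    proof (induction n arbitrary: w)
      case 0
      from coherentD[OF assms 0] have "triple (pfst c) a w \<in> D"
        by (cases rule: justified_cases) (use e in \<open>simp_all, presburger+\<close>)
      then show ?case using IH e by (simp add: prog_of_Prec)
    next
      case (Suc n)
      from coherentD[OF assms Suc.prems] obtain y where
        "triple e (pair a n) y \<in> D" "triple (psnd c) (pair a (pair n y)) w \<in> D"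
        by (cases rule: justified_cases) (use e in \<open>simp_all, presburger+\<close>)
      then have "run (prog_of e) ?Z (pair a n) = Some y"
        "run (prog_of (psnd c)) ?Z (pair a (pair n y)) = Some w"
        using Suc.IH IH' by blast+
      then show ?case using e by (simp add: prog_of_Prec)
    qed
    from this[of "pfst x" "psnd x" v] show ?thesis using less.prems by simp
  qed
  show ?case
    using coherentD[OF assms less.prems]
  proof (cases rule: justified_cases)
    case (Pairing c)
    have "run (prog_of (pfst c)) ?Z x = Some (pfst v)" "run (prog_of (psnd c)) ?Z x = Some (psnd v)"
      using less.IH Pairing smaller by auto
    then show ?thesis unfolding Pairing(1) prog_of_Pairing by simp
  next
    case (Comp c y)
    have "run (prog_of (psnd c)) ?Z x = Some y" "run (prog_of (pfst c)) ?Z y = Some v"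
      using less.IH Comp smaller[of c] by auto
    then show ?thesis unfolding Comp(1) prog_of_Comp by simp
  next
    case (Mu c)
    have IH: "run (prog_of c) ?Z y = Some w" if "triple c y w \<in> D" for y w
      using less.IH Mu(1) that by simp
    show ?thesis unfolding Mu(1) prog_of_Mu
      using IH Mu by (intro run_Mu_eqI) blast+
  next
    case Prec0
    then show ?thesis using Prec by blast
  next
    case PrecSuc
    then show ?thesis using Prec by blast
  qed (simp_all add: prog_of_basic[unfolded One_nat_def])
qed

definition derivable :: "(nat \<Rightarrow> nat) \<Rightarrow> nat \<Rightarrow> bool" where
  "derivable z t \<longleftrightarrow> (\<exists>D. finite D \<and> coherent z D \<and> t \<in> D)"

text \<open>Certificates of finitely many premises can be united, because justification is monotone;
  adding the new claim keeps the union coherent. Completeness thus reduces to one inference step per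
  program construct.\<close>

lemma derivableI:
  assumes "finite Q" "\<And>t. t \<in> Q \<Longrightarrow> derivable z t" "justified z Q e x v"
  shows "derivable z (triple e x v)"
proof -
  obtain D where D: "\<And>t. t \<in> Q \<Longrightarrow> finite (D t) \<and> coherent z (D t) \<and> t \<in> D t"
    using assms(2) unfolding derivable_def by metis
  let ?E = "insert (triple e x v) (\<Union>t\<in>Q. D t)"
  have "Q \<subseteq> ?E" using D by blast
  then have "justified z ?E e x v" using assms(3) justified_mono by blast
  moreover have "justified z ?E (pfst t) (pfst (psnd t)) (psnd (psnd t))" if "t \<in> (\<Union>t\<in>Q. D t)" for t
    using that D by (auto simp: coherent_def intro: justified_mono)
  ultimately have "coherent z ?E" by (simp add: coherent_def)
  then show ?thesis using D assms(1) unfolding derivable_def by (intro exI[of _ ?E]) simp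
qed

lemma prog_code_cases:
  obtains "e = 0" | "e = 1" | "e = 2" | "e = 3" | "e = 4"
  | (Pairing) c where "e = 5 + 4 * c" | (Comp) c where "e = 6 + 4 * c"
  | (Prec) c where "e = 7 + 4 * c" | (Mu) c where "e = 8 + 4 * (c :: nat)"
proof -
  have "e < 5 \<or> (\<exists>c. e = 5 + 4 * c \<or> e = 6 + 4 * c \<or> e = 7 + 4 * c \<or> e = 8 + 4 * c)"
    by presburger
  moreover have "e = 0 \<or> e = 1 \<or> e = 2 \<or> e = 3 \<or> e = 4" if "e < 5" using that by linarith
  ultimately show ?thesis using that by blast
qed

lemma derivable_complete:
  "run (prog_of e) (\<lambda>n. Some (z n)) x = Some v \<Longrightarrow> derivable z (triple e x v)"
proof (induction e arbitrary: x v rule: less_induct)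
  case (less e)
  let ?Z = "\<lambda>n. Some (z n)"
  have smaller: "pfst c < 5 + 4 * c" "psnd c < 5 + 4 * c" for c
    using prod_decode_le[of c] by linarith+
  show ?case
  proof (cases e rule: prog_code_cases)
    case (Pairing c)
    obtain a b where ab: "run (prog_of (pfst c)) ?Z x = Some a" "run (prog_of (psnd c)) ?Z x = Some b"
      "v = pair a b"
      using less.prems unfolding Pairing prog_of_Pairing by (auto simp: bind_eq_Some_conv)
    let ?Q = "{triple (pfst c) x a, triple (psnd c) x b}"
    show ?thesis unfolding Pairing ab(3)
      using ab less.IH smaller[of c] Pairing
      by (intro derivableI[of ?Q] justified_PairingI) auto
  next
    case (Comp c)
    obtain y where y: "run (prog_of (psnd c)) ?Z x = Some y" "run (prog_of (pfst c)) ?Z y = Some v"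
      using less.prems unfolding Comp prog_of_Comp by (auto simp: bind_eq_Some_conv)
    let ?Q = "{triple (psnd c) x y, triple (pfst c) y v}"
    show ?thesis unfolding Comp
      using y less.IH smaller[of c] Comp
      by (intro derivableI[of ?Q] justified_CompI[of _ _ y]) auto
  next
    case (Prec c)
    have "run (prog_of e) ?Z (pair a n) = Some w \<Longrightarrow> derivable z (triple e (pair a n) w)" for a n w
    proof (induction n arbitrary: w)
      case 0
      then have "run (prog_of (pfst c)) ?Z a = Some w" by (simp add: Prec prog_of_Prec)
      then show ?case unfolding Prec
        using less.IH smaller[of c] Prec
        by (intro derivableI[of "{triple (pfst c) a w}"] justified_Prec0I) auto
    next
      case (Suc n)
      then obtain y where y: "run (prog_of e) ?Z (pair a n) = Some y"
        "run (prog_of (psnd c)) ?Z (pair a (pair n y)) = Some w"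
        by (auto simp: Prec prog_of_Prec bind_eq_Some_conv)
      let ?Q = "{triple e (pair a n) y, triple (psnd c) (pair a (pair n y)) w}"
      have "derivable z t" if "t \<in> ?Q" for t
        using that y Suc.IH less.IH smaller[of c] Prec by auto
      moreover have "justified z ?Q e (pair a (Suc n)) w"
        unfolding Prec by (rule justified_PrecSucI[of _ _ _ y]) auto
      ultimately show ?case by (intro derivableI[of ?Q]) auto
    qed
    from this[of "pfst x" "psnd x" v] show ?thesis using less.prems by simp
  next
    case (Mu c)
    let ?f = "\<lambda>n. run (prog_of c) ?Z (pair x n)"
    have "\<exists>n. ?f n = Some 0 \<and> (\<forall>m<n. \<exists>v. ?f m = Some (Suc v))" and v: "v = (LEAST n. ?f n = Some 0)"
      using less.prems unfolding Mu prog_of_Mu by (auto split: if_splits)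
    then obtain n where n: "?f n = Some 0" "\<forall>m<n. \<exists>v. ?f m = Some (Suc v)" by blast
    have "v = n" unfolding v
      using n by (intro Least_equality) (auto simp: not_less[symmetric])
    obtain g where g: "\<And>m. m < n \<Longrightarrow> ?f m = Some (Suc (g m))" using n(2) by metis
    \<comment> \<open>The premises of a \<open>Mu\<close> claim: the zero found at \<open>n\<close>
      and the nonzero values before it.\<close>
    let ?Q = "insert (triple c (pair x n) 0) ((\<lambda>m. triple c (pair x m) (Suc (g m))) ` {..<n})"
    have "derivable z t" if "t \<in> ?Q" for t
      using that less.IH[of c] n g Mu by auto
    then show ?thesis unfolding Mu \<open>v = n\<close>
      by (intro derivableI[of ?Q] justified_MuI) auto
  qed (use less.prems in \<open>auto simp: prog_of_basic[unfolded One_nat_def] justified_def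
      intro!: derivableI[of "{}"]\<close>)
qed

lemma less_of_mem_set_decode: "n \<in> set_decode w \<Longrightarrow> n < w"
proof -
  assume "n \<in> set_decode w"
  then have "2 ^ n \<le> w"
    by (metis div_less even_zero linorder_not_le mem_Collect_eq set_decode_def)
  then show ?thesis using less_exp[of n] by linarith
qed

text \<open>A member of a coded finite set is below the code, and a component never exceeds its
  pair. This bounds the existential quantifiers of \<open>justified\<close>, as decidability
  requires.\<close>

lemma ex_triple_bounded:
  "(\<exists>y. triple a x y \<in> set_decode w \<and> P y) \<longleftrightarrow> (\<exists>y<w. triple a x y \<in> set_decode w \<and> P y)"
  by (meson le_prod_encode_2 le_trans less_of_mem_set_decode order.strict_trans1)

lemma pcomp_universal:
  assumes "Z = (\<lambda>n. Some (z n))"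
  shows "pcomp Z (\<lambda>s. run (prog_of (pfst s)) Z (psnd s))"
proof -
  have tz: "tcomp Z z" by (rule tcompI[of Query]) (simp add: assms)
  \<comment> \<open>The witness \<open>t\<close> codes a finite set of claims together with the
    proposed value \<open>psnd t\<close>.\<close>
  define W where "W s t \<longleftrightarrow>
      (\<forall>y<pfst t. y \<in> set_decode (pfst t) \<longrightarrow>
        justified z (set_decode (pfst t)) (pfst y) (pfst (psnd y)) (psnd (psnd y))) \<and>
      triple (pfst s) (psnd s) (psnd t) \<in> set_decode (pfst t)" for s t
  have "decidable Z (\<lambda>r. W (pfst r) (psnd r))"
    unfolding W_def justified_def ex_triple_bounded
    by (intro decidable_intros tcomp_intros tcomp_compose[OF tz])
  note search = pcomp_search[OF this]
  have W: "W s t \<longleftrightarrow> coherent z (set_decode (pfst t)) \<and>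
      triple (pfst s) (psnd s) (psnd t) \<in> set_decode (pfst t)" for s t
    unfolding W_def coherent_def using less_of_mem_set_decode by blast
  have sound: "run (prog_of (pfst s)) Z (psnd s) = Some (psnd t)" if "W s t" for s t
    using that coherent_sound unfolding W assms by blast
  have complete: "\<exists>t. W s t" if "run (prog_of (pfst s)) Z (psnd s) = Some v" for s v
  proof -
    have "derivable z (triple (pfst s) (psnd s) v)"
      using that unfolding assms by (rule derivable_complete)
    then obtain D where "finite D" "coherent z D" "triple (pfst s) (psnd s) v \<in> D"
      by (auto simp: derivable_def)
    then have "W s (pair (set_encode D) v)" unfolding W by simp
    then show ?thesis by blast
  qed
  have "pcomp Z (\<lambda>s. Option.bind (if \<exists>t. W s t then Some (LEAST t. W s t) else None) (\<lambda>t. Some (psnd t)))"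
    by (intro pcomp_bind search pcomp_Some tcomp_intros)
  moreover have "Option.bind (if \<exists>t. W s t then Some (LEAST t. W s t) else None) (\<lambda>t. Some (psnd t))
      = run (prog_of (pfst s)) Z (psnd s)" for s
  proof (cases "\<exists>t. W s t")
    case True
    then have "W s (LEAST t. W s t)" by (rule LeastI_ex)
    then show ?thesis using True sound by simp
  next
    case False
    then show ?thesis using complete by (cases "run (prog_of (pfst s)) Z (psnd s)") auto
  qed
  ultimately show ?thesis by simp
qed

text \<open>The s-m-n theorem: \<open>h c\<close> indexes \<open>p\<close> composed with the pairing
  of the constant \<open>c\<close> and the identity. Only index arithmetic is involved, so
  \<open>h\<close> is computable in any \<open>Y\<close>.\<close>

lemma tcomp_smn:
  assumes "pcomp Z f"
  obtains h where "tcomp Y h" "\<And>c x. run (prog_of (h c)) Z x = f (pair c x)"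
proof -
  obtain p where p: "run p Z = f" using assms by (auto simp: pcomp_def)
  obtain a i where a: "prog_of a = p" and i: "prog_of i = Pairing Left Right"
    using surj_prog_of by (metis surjD)
  \<comment> \<open>Composing \<open>Succ\<close> (index 1) \<open>c\<close> times onto
    \<open>Zero\<close> (index 0) yields an index of the constant \<open>c\<close>.\<close>
  define k where "k = (\<lambda>c. rec_nat 0 (\<lambda>m r. 6 + 4 * pair 1 r) c)"
  have k: "run (prog_of (k c)) Z x = Some c" for c x
    by (induction c) (simp_all add: k_def prog_of_basic prog_of_Comp del: One_nat_def)
  define h where "h = (\<lambda>c. 6 + 4 * pair a (5 + 4 * pair (k c) i))"
  have 4: "4 * c = c + c + c + c" for c :: nat by simp
  have "tcomp Y k" unfolding k_def 4 by (intro tcomp_rec tcomp_intros)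
  then have "tcomp Y h" unfolding h_def 4 by (intro tcomp_intros)
  moreover have "run (prog_of (h c)) Z x = f (pair c x)" for c x
    by (simp add: h_def prog_of_Comp prog_of_Pairing k a i p)
  ultimately show ?thesis using that by blast
qed

section \<open>Sets and functions computable in \<open>X\<close>\<close>

lemma char_fun_total: "char_fun X = (\<lambda>n. Some (if n \<in> X then 1 else 0))"
  by (rule ext) (simp add: char_fun_def)

lemma partial_computable_in_iff: "partial_computable_in X f \<longleftrightarrow> pcomp (char_fun X) f"
  using surj_prog_of unfolding partial_computable_in_def pcomp_def Phi_def by (metis surjD)

lemma pcomp_None: "pcomp Z (\<lambda>s. None)"
  using pcomp_search[of Z "\<lambda>s n. False"] by (simp add: decidable_const)

text \<open>Uniform in the right-hand argument: \<open>f\<close> is fixed, so \<open>f 0\<close>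
  names one fixed program, and only its oracle varies with the parameter.\<close>

lemma pcomp_B_app:
  assumes f: "pcomp Z f" and Y: "pcomp Z (\<lambda>z. Y (pfst z) (psnd z))"
  shows "pcomp Z (\<lambda>z. B_app f (Y (pfst z)) (psnd z))"
proof (cases "f 0")
  case None
  then show ?thesis by (simp add: B_app_def pcomp_None)
next
  case (Some e)
  have "pcomp Z (\<lambda>z. Y (pfst z) (psnd z div 2))"
    using pcomp_compose[OF Y, of "\<lambda>z. pair (pfst z) (psnd z div 2)"]
    by (simp add: tcomp_intros tcomp_half)
  then have "pcomp Z (\<lambda>z. fun_join f (Y (pfst z)) (psnd z))"
    unfolding fun_join_def
    by (intro pcomp_if decidable_even pcomp_compose[OF f] tcomp_half tcomp_psnd tcomp_id)
  from pcomp_subst_oracle[OF this] show ?thesis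
    by (simp add: B_app_def Phi_def Some)
qed

lemma ce_dom: "pcomp (char_fun {}) f \<Longrightarrow> ce (dom f)"
  by (auto simp: ce_def partial_computable_in_iff)

lemma ce_decidable:
  assumes "decidable (char_fun {}) P" shows "ce {n. P n}"
proof -
  have "pcomp (char_fun {}) (\<lambda>s. if P s then Some 0 else None)"
    by (intro pcomp_if assms pcomp_Some tcomp_const pcomp_None)
  moreover have "dom (\<lambda>s. if P s then Some 0 else None) = {n. P n}"
    by (auto split: if_splits)
  ultimately show ?thesis by (metis ce_dom)
qed

lemma ce_finite:
  assumes "finite A" shows "ce A"
proof -
  have "ce {n. n \<in> set_decode (set_encode A)}"
    by (intro ce_decidable decidable_set_decode tcomp_intros)
  then show ?thesis using assms by (simp add: set_encode_inverse)
qed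

section \<open>Sets c.e. in X as elements of the graph model\<close>

lemma set_join_even: "n + n \<in> set_join X Y \<longleftrightarrow> n \<in> X"
proof -
  have "n + n \<noteq> Suc (2 * m)" for m by presburger
  moreover have "n + n = 2 * m \<longleftrightarrow> n = m" for m by linarith
  ultimately show ?thesis by (auto simp: set_join_def)
qed

lemma set_join_odd: "Suc (n + n) \<in> set_join X Y \<longleftrightarrow> n \<in> Y"
proof -
  have "Suc (n + n) \<noteq> 2 * m" for m by presburger
  moreover have "n + n = 2 * m \<longleftrightarrow> n = m" for m by linarith
  ultimately show ?thesis by (auto simp: set_join_def)
qed

text \<open>Reads a finite set as partial information about \<open>X\<close>: the element
  \<open>2 * y\<close> asserts that \<open>y\<close> lies in \<open>X\<close>, and
  \<open>2 * y + 1\<close> that it does not.\<close>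

definition oracle_part :: "nat \<Rightarrow> nat \<rightharpoonup> nat" where
  "oracle_part u y = (if y + y \<in> set_decode u then Some 1
     else if Suc (y + y) \<in> set_decode u then Some 0 else None)"

lemma pcomp_oracle_part: "pcomp Z (\<lambda>z. oracle_part (pfst z) (psnd z))"
  unfolding oracle_part_def
  by (intro pcomp_if decidable_set_decode pcomp_Some pcomp_None tcomp_intros)

lemma oracle_part_le:
  assumes "set_decode u \<subseteq> set_join X (- X)" shows "oracle_part u \<subseteq>\<^sub>m char_fun X"
proof -
  have "y \<in> X" if "y + y \<in> set_decode u" for y
    using that assms set_join_even[of y X "- X"] by blast
  moreover have "y \<notin> X" if "Suc (y + y) \<in> set_decode u" for y
    using that assms set_join_odd[of y X "- X"] by blast
  ultimately show ?thesis
    by (auto simp: map_le_def oracle_part_def char_fun_def split: if_splits)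
qed

lemma le_oracle_part:
  assumes "finite D"
  obtains u where "set_decode u \<subseteq> set_join X (- X)" "char_fun X |` D \<subseteq>\<^sub>m oracle_part u"
proof -
  let ?E = "(\<lambda>n. n + n) ` (D \<inter> X) \<union> (\<lambda>n. Suc (n + n)) ` (D - X)"
  have E: "set_decode (set_encode ?E) = ?E" using assms by (intro set_encode_inverse) simp
  have "y + y \<noteq> Suc (n + n)" "Suc (n + n) \<noteq> y + y" "y + y = n + n \<longleftrightarrow> y = n" for y n :: nat
    by presburger+
  then have "char_fun X |` D \<subseteq>\<^sub>m oracle_part (set_encode ?E)"
    unfolding map_le_def oracle_part_def E by (auto simp: char_fun_def)
  moreover have "set_decode (set_encode ?E) \<subseteq> set_join X (- X)"
    unfolding E by (auto simp: set_join_even set_join_odd)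
  ultimately show ?thesis using that by blast
qed

text \<open>A set c.e. in \<open>X\<close> is enumeration reducible to the join of \<open>X\<close>
  and its complement. The c.e. operator consists of the pairs \<open>(n, u)\<close> such that the
  program halts on \<open>n\<close> with the finite oracle read off from \<open>u\<close>;
  monotonicity and the use principle make it produce exactly \<open>dom f\<close>.\<close>

lemma dom_in_graph_dom:
  assumes "pcomp (char_fun X) f" shows "dom f \<in> graph_dom (set_join X (- X))"
proof -
  obtain p where p: "run p (char_fun X) = f" using assms by (auto simp: pcomp_def)
  let ?g = "\<lambda>z. run p (oracle_part (psnd z)) (pfst z)"
  have "pcomp (char_fun {}) ?g"
    using pcomp_compose[OF pcomp_subst_oracle[OF pcomp_oracle_part], of _ "\<lambda>z. pair (psnd z) (pfst z)"]
    by (simp add: tcomp_intros)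
  then have "graph_app (dom ?g) (set_join X (- X)) \<in> graph_dom (set_join X (- X))"
    by (intro graph_dom.app graph_dom.generator graph_dom.ce ce_dom)
  also have "graph_app (dom ?g) (set_join X (- X)) = dom f"
  proof (intro set_eqI iffI)
    fix n assume "n \<in> graph_app (dom ?g) (set_join X (- X))"
    then obtain u v where "set_decode u \<subseteq> set_join X (- X)" "run p (oracle_part u) n = Some v"
      by (auto simp: graph_app_def)
    then have "run p (char_fun X) n = Some v" using run_mono oracle_part_le by blast
    then show "n \<in> dom f" using p by auto
  next
    fix n assume "n \<in> dom f"
    then obtain v where "run p (char_fun X) n = Some v" using p by auto
    then obtain D where D: "finite D" "run p (char_fun X |` D) n = Some v"
      using run_finite_use by blast
    obtain u where "set_decode u \<subseteq> set_join X (- X)" "char_fun X |` D \<subseteq>\<^sub>m oracle_part u"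
      using D le_oracle_part by blast
    moreover from this have "run p (oracle_part u) n = Some v" using D run_mono by blast
    ultimately show "n \<in> graph_app (dom ?g) (set_join X (- X))"
      unfolding graph_app_def dom_def by auto
  qed
  finally show ?thesis .
qed

section \<open>The halting problem relative to X and switching between finite sets\<close>

definition halting :: "nat set \<Rightarrow> nat \<rightharpoonup> nat" where
  "halting X e = run (prog_of e) (char_fun X) e"

lemma pcomp_halting: "pcomp (char_fun X) (halting X)"
  using pcomp_compose[OF pcomp_universal[OF char_fun_total], of X "\<lambda>s. pair s s"]
  by (simp add: tcomp_intros halting_def[abs_def])

text \<open>Diagonalization: at an index of \<open>f\<close> itself, \<open>f\<close> and
  \<open>halting X\<close> converge together.\<close>

lemma dom_halting_compl: "pcomp (char_fun X) f \<Longrightarrow> dom f \<noteq> - dom (halting X)"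
proof
  assume "pcomp (char_fun X) f" "dom f = - dom (halting X)"
  then obtain e where "run (prog_of e) (char_fun X) = f"
    using surj_prog_of unfolding pcomp_def by (metis surjD)
  then have "e \<in> dom f \<longleftrightarrow> e \<in> dom (halting X)" by (auto simp: halting_def)
  then show False using \<open>dom f = - dom (halting X)\<close> by blast
qed

lemma set_decode_power_2: "set_decode (2 ^ n) = {n}"
  using set_encode_inverse[of "{n}"] by simp

text \<open>The switch outputs \<open>A\<close> from empty input information, and adds
  \<open>B\<close> once it sees an element of the input at which \<open>halting X\<close> is
  defined. These conditions are c.e. in \<open>X\<close>, so the switch belongs to the graph
  model.\<close>

lemma graph_switch:
  assumes "finite A" "finite B"
  obtains k where "k \<in> graph_dom (set_join X (- X))"
    "\<And>n. graph_app k {n} = (if n \<in> dom (halting X) then A \<union> B else A)"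
proof -
  let ?Z = "char_fun X"
  \<comment> \<open>The empty set and the full set are domains of \<open>X\<close>-computable
    functions, so the halting set is neither full nor empty.\<close>
  obtain n1 where n1: "n1 \<notin> dom (halting X)"
    using dom_halting_compl[OF pcomp_None, of X] by auto
  obtain n0 where n0: "n0 \<in> dom (halting X)"
    using dom_halting_compl[OF pcomp_Some[OF tcomp_const[of _ 0]], of X] by (auto simp: dom_def)
  \<comment> \<open>All conditions on a pair become one halting question: \<open>n0\<close> stands
    for acceptance, \<open>n1\<close> for rejection, and the least element of a nonempty input set
    is asked about itself. The disjunct \<open>psnd z = 0\<close> keeps the search for that element
    total.\<close>
  define g where "g z = (if psnd z = 0 then if pfst z \<in> set_decode (set_encode A) then n0 else n1
    else if pfst z \<in> set_decode (set_encode B)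
      then (LEAST n. n \<in> set_decode (psnd z) \<or> psnd z = 0) else n1)" for z
  have ex: "\<exists>n. n \<in> set_decode u \<or> u = 0" for u
    by (metis equals0I set_decode_inverse set_encode_empty)
  have "tcomp ?Z g"
    unfolding g_def
    by (intro tcomp_if tcomp_Least decidable_intros tcomp_intros ex)
  then have "pcomp ?Z (\<lambda>z. halting X (g z))"
    by (intro pcomp_compose[OF pcomp_halting])
  then have "dom (\<lambda>z. halting X (g z)) \<in> graph_dom (set_join X (- X))" (is "?k \<in> _")
    by (rule dom_in_graph_dom)
  moreover have "graph_app ?k {n} = (if n \<in> dom (halting X) then A \<union> B else A)" for n
  proof -
    have k0: "pair j 0 \<in> ?k \<longleftrightarrow> j \<in> A" for j
      using n0 n1 assms by (auto simp: g_def set_encode_inverse)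
    have k1: "pair j u \<in> ?k \<longleftrightarrow> j \<in> B \<and> n \<in> dom (halting X)" if u: "set_decode u = {n}" for j u
    proof -
      have "u \<noteq> 0" using u by (metis empty_not_insert set_decode_zero)
      moreover have "(LEAST m. m \<in> set_decode u) = n" unfolding u by (rule Least_equality) auto
      ultimately have "g (pair j u) = (if j \<in> B then n else n1)"
        using assms by (simp add: g_def set_encode_inverse)
      then show ?thesis using n1 by (auto split: if_splits)
    qed
    have "set_decode u \<subseteq> {n} \<longleftrightarrow> u = 0 \<or> set_decode u = {n}" for u
      by (metis set_decode_inverse set_encode_empty subset_singleton_iff set_decode_zero)
    then have "j \<in> graph_app ?k {n} \<longleftrightarrow>
        pair j 0 \<in> ?k \<or> (\<exists>u. set_decode u = {n} \<and> pair j u \<in> ?k)" for j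
      unfolding graph_app_def by auto
    moreover have "(\<exists>u. set_decode u = {n} \<and> pair j u \<in> ?k) \<longleftrightarrow> j \<in> B \<and> n \<in> dom (halting X)" for j
      using k1[of _ j] k1[OF set_decode_power_2, of j] set_decode_power_2[of n] by meson
    ultimately have "j \<in> graph_app ?k {n} \<longleftrightarrow> j \<in> A \<or> j \<in> B \<and> n \<in> dom (halting X)" for j
      using k0[of j] by presburger
    then show ?thesis by auto
  qed
  ultimately show ?thesis using that by blast
qed

lemma ce_successor: "\<exists>S. ce S \<and> (\<forall>n. graph_app S {n} = {Suc n})"
proof -
  \<comment> \<open>The operator lists \<open>Suc m\<close> as soon as \<open>m\<close> appears in
    the input.\<close>
  let ?P = "\<lambda>z. \<exists>m<pfst z. pfst z = Suc m \<and> m \<in> set_decode (psnd z)"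
  have "ce {z. ?P z}"
    by (intro ce_decidable decidable_intros tcomp_intros)
  moreover have "graph_app {z. ?P z} {n} = {Suc n}" for n
    using set_decode_power_2[of n] by (auto simp: graph_app_def)
  ultimately show ?thesis by blast
qed

section \<open>Weak embeddings into \<open>B_model X\<close>\<close>

locale graph_embedding =
  fixes X :: "nat set" and F :: "nat set \<Rightarrow> nat \<rightharpoonup> nat"
  assumes embedding: "weak_embedding (graph_model (set_join X (- X))) (B_model X) F"
begin

abbreviation "G \<equiv> graph_dom (set_join X (- X))"

lemma F_pcomp: "A \<in> G \<Longrightarrow> pcomp (char_fun X) (F A)"
  using embedding
  by (auto simp: weak_embedding_def graph_model_def B_model_def partial_computable_in_iff)

lemma F_app: "A \<in> G \<Longrightarrow> B \<in> G \<Longrightarrow> F (graph_app A B) = B_app (F A) (F B)"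
  using embedding by (auto simp: weak_embedding_def graph_model_def B_model_def)

lemma F_inj: "A \<in> G \<Longrightarrow> B \<in> G \<Longrightarrow> F A = F B \<Longrightarrow> A = B"
  using embedding by (auto simp: weak_embedding_def graph_model_def inj_on_def)

lemma finite_in_G: "finite A \<Longrightarrow> A \<in> G"
  by (intro graph_dom.ce ce_finite)

text \<open>The map \<open>F\<close> itself need not be effective. Uniformity comes from
  \<open>F {Suc n}\<close> being the application of the fixed function \<open>F S\<close> to
  \<open>F {n}\<close>: the universal program and s-m-n turn this into a computable step from index
  to index.\<close>

lemma pcomp_numerals: "pcomp (char_fun X) (\<lambda>z. F {pfst z} (psnd z))"
proof -
  let ?Z = "char_fun X"
  note U = pcomp_universal[OF char_fun_total[of X]]
  obtain S where S: "ce S" "\<And>n. graph_app S {n} = {Suc n}" using ce_successor by blast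
  have SG: "S \<in> G" using S by (intro graph_dom.ce)
  have "pcomp ?Z (\<lambda>z. B_app (F S) (run (prog_of (pfst z)) ?Z) (psnd z))"
    by (intro pcomp_B_app F_pcomp SG U)
  then obtain h where h: "tcomp ?Z h"
    "\<And>c x. run (prog_of (h c)) ?Z x = B_app (F S) (run (prog_of c) ?Z) x"
    by (rule tcomp_smn) auto
  obtain c0 where c0: "run (prog_of c0) ?Z = F {0}"
    using F_pcomp[OF finite_in_G[of "{0}"]] surj_prog_of unfolding pcomp_def
    by (metis finite.emptyI finite.insertI surjD)
  \<comment> \<open>An index of \<open>F {n}\<close>; the start \<open>c0\<close> is a single
    number, so no effective way of finding it is required.\<close>
  define c where "c n = rec_nat c0 (\<lambda>m r. h r) n" for n
  have c: "run (prog_of (c n)) ?Z = F {n}" for n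
  proof (induction n)
    case 0
    show ?case by (simp add: c_def c0)
  next
    case (Suc n)
    have "run (prog_of (c (Suc n))) ?Z = B_app (F S) (F {n})"
      using Suc by (intro ext) (simp add: c_def h)
    then show ?case using F_app[OF SG finite_in_G[of "{n}"]] S by simp
  qed
  have tc: "tcomp ?Z c" unfolding c_def
    by (intro tcomp_rec tcomp_compose[OF h(1)] tcomp_intros)
  have "tcomp ?Z (\<lambda>z. pair (c (pfst z)) (psnd z))"
    by (intro tcomp_pair tcomp_compose[OF tc] tcomp_intros)
  from pcomp_compose[OF U this] show ?thesis by (simp add: c)
qed

lemma F_mono:
  assumes "finite A" "finite B" "A \<subseteq> B" shows "F A \<subseteq>\<^sub>m F B"
proof (rule ccontr)
  let ?Z = "char_fun X"
  assume "\<not> F A \<subseteq>\<^sub>m F B"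
  then obtain m v where A: "F A m = Some v" and B: "F B m \<noteq> Some v"
    by (auto simp: map_le_def)
  obtain k where k: "k \<in> G" "\<And>n. graph_app k {n} = (if n \<in> dom (halting X) then A \<union> B else A)"
    using graph_switch[OF assms(1,2)] by blast
  have "A \<union> B = B" using assms by blast
  then have F: "B_app (F k) (F {n}) = (if n \<in> dom (halting X) then F B else F A)" for n
    using F_app[OF k(1) finite_in_G[of "{n}"]] k(2)[of n] by (auto split: if_splits)
  have "pcomp ?Z (\<lambda>n. B_app (F k) (F {n}) m)"
    using pcomp_compose[OF pcomp_B_app[OF F_pcomp[OF k(1)] pcomp_numerals], of "\<lambda>n. pair n m"]
    by (simp add: tcomp_intros)
  \<comment> \<open>Converges only on the value \<open>v\<close>, so an undefined
    \<open>F B m\<close> and a different value of \<open>F B m\<close> both become divergence. The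
    domain is then the complement of the halting set.\<close>
  then have "pcomp ?Z (\<lambda>n. Option.bind (B_app (F k) (F {n}) m)
      (\<lambda>w. if w = v then Some 0 else None))" (is "pcomp _ ?f")
    by (intro pcomp_bind pcomp_if decidable_intros tcomp_intros pcomp_Some pcomp_None)
  moreover have "?f n \<noteq> None \<longleftrightarrow> n \<notin> dom (halting X)" for n
    unfolding F using A B by (auto split: Option.bind_split)
  then have "dom ?f = - dom (halting X)" by auto
  ultimately show False using dom_halting_compl by blast
qed

lemma contradiction: False
proof -
  obtain u1 u2 where u: "set_decode u1 = {0}" "set_decode u2 = {1}"
    using set_decode_power_2 by blast
  let ?A1 = "{pair 0 u1}" and ?A2 = "{pair 0 u2}"
  have app: "graph_app ?A1 {0} = {0}" "graph_app ?A2 {1} = {0}" "graph_app ?A1 {1} = {}"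
    unfolding graph_app_def by (auto simp: u)
  have F: "B_app (F ?A1) (F {0}) = F {0}" "B_app (F ?A2) (F {1}) = F {0}"
    "B_app (F ?A1) (F {1}) = F {}"
    using F_app[OF finite_in_G finite_in_G, of ?A1 "{0}"] F_app[OF finite_in_G finite_in_G, of ?A2 "{1}"]
      F_app[OF finite_in_G finite_in_G, of ?A1 "{1}"] unfolding app by simp_all
  have "F {} \<subseteq>\<^sub>m F {0}" by (intro F_mono) auto
  moreover have "F {} \<noteq> F {0}" using F_inj[OF finite_in_G finite_in_G, of "{}" "{0}"] by auto
  ultimately obtain m v where m: "F {0} m = Some v" "F {} m \<noteq> Some v"
    by (metis map_le_antisym map_le_def domD)
  \<comment> \<open>Images of unions are common extensions, which gives compatibility of the two
    operators and of the two arguments.\<close>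
  have le: "F ?A1 \<subseteq>\<^sub>m F (?A1 \<union> ?A2)" "F ?A2 \<subseteq>\<^sub>m F (?A1 \<union> ?A2)" "F {0} \<subseteq>\<^sub>m F {0, 1}" "F {1} \<subseteq>\<^sub>m F {0, 1}"
    by (intro F_mono; simp)+
  have agree: "a = b" if "f \<subseteq>\<^sub>m h" "g \<subseteq>\<^sub>m h" "f q = Some a" "g q = Some b"
    for f g h :: "nat \<rightharpoonup> nat" and q a b
    using that by (metis domI map_le_def option.inject)
  have app_m: "B_app (F ?A1) (F {0}) m = Some v" "B_app (F ?A2) (F {1}) m = Some v"
    using F m(1) by simp_all
  obtain e where e: "F ?A1 0 = Some e" "Phi e (fun_join (F ?A1) (F {0})) m = Some v"
    using app_m(1) by (auto simp: B_app_def bind_eq_Some_conv)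
  obtain e' where e': "F ?A2 0 = Some e'" "Phi e' (fun_join (F ?A2) (F {1})) m = Some v"
    using app_m(2) by (auto simp: B_app_def bind_eq_Some_conv)
  \<comment> \<open>Compatibility at 0 means that both applications run the same program, so
    stability can compare them.\<close>
  have "e' = e" using agree[OF le(1,2)] e e' by blast
  \<comment> \<open>The mixed oracle shares its even half with the first oracle and its odd half
    with the second, hence extends their intersection.\<close>
  have stable: "a = b \<and> fun_join (F ?A1) (F {1}) q = Some a"
    if "fun_join (F ?A1) (F {0}) q = Some a" "fun_join (F ?A2) (F {1}) q = Some b" for q a b
    using that agree[OF le(1,2), of "q div 2" a b] agree[OF le(3,4), of "q div 2" a b]
    by (cases "even q") (simp_all add: fun_join_def)
  have "Phi e (fun_join (F ?A1) (F {1})) m = Some v"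
    using run_stable[of "fun_join (F ?A1) (F {0})" "fun_join (F ?A2) (F {1})"
        "fun_join (F ?A1) (F {1})" "prog_of e" m v v, OF stable] e(2) e'(2)
    unfolding \<open>e' = e\<close> Phi_def by simp
  then have "B_app (F ?A1) (F {1}) m = Some v" using e by (simp add: B_app_def)
  then show False using F(3) m by simp
qed

end

theorem theorem3p2:
  fixes X :: "nat set"
  shows "\<not> weakly_embeds (graph_model (set_join X (- X))) (B_model X)"
  using graph_embedding.contradiction unfolding weakly_embeds_def graph_embedding_def by blast

end
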